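(* Let $d\geq 2$ and $n\geq 1$ be integers. Every annihilation function of $[n]^d$ can be decomposed into a finite sum of simple annihilation functions.
   Context: Notation: $[n]=\{1,\ldots,n\}$. A layer of $[n]^d$ is a hyperplane given by an equation $x_i=j$ with $i\in[d]$, $j\in[n]$. An annihilation function of $[n]^d$ is a function $f\colon[n]^d\to\mathbb{Z}$ such that $\sum_{x\in L\cap[n]^d} f(x)=0$ for each layer $L$. For $x\in[n]^d$, $\mathbf{1}_x\colon[n]^d\to\mathbb{Z}$ is the indicator function of $x$: $\mathbf{1}_x(y)=1$ if $y=x$ and $0$ otherwise. If $P,Q,R,S\in[n]^d$ are the consecutive vertices of a rectangle whose sides are parallel to the coordinate axes, the function $f_{PQRS}=\mathbf{1}_P-\mathbf{1}_Q+\mathbf{1}_R-\mathbf{1}_S$ is called a simple annihilation function. Repetitions are allowed in the sum, and the zero function is regarded as the empty sum. *)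

theory Defs
  imports Main "HOL-Library.FuncSet"
begin

text \<open>Points of \<open>[n]^d\<close> are functions on the coordinate set \<open>{1..d}\<close>, extended by
  \<^const>\<open>undefined\<close> outside of it, so that equality of points is equality of all coordinates.\<close>

definition grid :: "nat \<Rightarrow> nat \<Rightarrow> (nat \<Rightarrow> nat) set" where
  "grid d n = {1..d} \<rightarrow>\<^sub>E {1..n}"

definition layers :: "nat \<Rightarrow> nat \<Rightarrow> (nat \<Rightarrow> nat) set set" where
  "layers d n = {{x. x i = j} | i j. i \<in> {1..d} \<and> j \<in> {1..n}}"

text \<open>A function \<open>[n]^d \<rightarrow> \<int>\<close> is represented by a total function on points; its values
  outside of \<^const>\<open>grid\<close> are irrelevant.\<close>

definition annihilation_function :: "nat \<Rightarrow> nat \<Rightarrow> ((nat \<Rightarrow> nat) \<Rightarrow> int) \<Rightarrow> bool" where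
  "annihilation_function d n f \<longleftrightarrow> (\<forall>L \<in> layers d n. (\<Sum>x \<in> L \<inter> grid d n. f x) = 0)"

definition point_indicator :: "(nat \<Rightarrow> nat) \<Rightarrow> (nat \<Rightarrow> nat) \<Rightarrow> int" where
  "point_indicator x y = (if y = x then 1 else 0)"

text \<open>\<open>P\<close>, \<open>Q\<close>, \<open>R\<close>, \<open>S\<close> are, in cyclic order, the vertices of a non-degenerate rectangle in
  \<open>[n]^d\<close> whose sides are parallel to the (distinct) coordinate axes \<open>i\<close> and \<open>j\<close>.\<close>

definition axis_rectangle ::
  "nat \<Rightarrow> nat \<Rightarrow> (nat \<Rightarrow> nat) \<Rightarrow> (nat \<Rightarrow> nat) \<Rightarrow> (nat \<Rightarrow> nat) \<Rightarrow> (nat \<Rightarrow> nat) \<Rightarrow> bool" where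
  "axis_rectangle d n P Q R S \<longleftrightarrow>
     P \<in> grid d n \<and> Q \<in> grid d n \<and> R \<in> grid d n \<and> S \<in> grid d n \<and>
     (\<exists>i \<in> {1..d}. \<exists>j \<in> {1..d}. \<exists>a b. i \<noteq> j \<and> a \<noteq> P i \<and> b \<noteq> P j \<and>
        Q = P(i := a) \<and> R = P(i := a, j := b) \<and> S = P(j := b))"

definition simple_annihilation_function :: "nat \<Rightarrow> nat \<Rightarrow> ((nat \<Rightarrow> nat) \<Rightarrow> int) \<Rightarrow> bool" where
  "simple_annihilation_function d n g \<longleftrightarrow>
     (\<exists>P Q R S. axis_rectangle d n P Q R S \<and>
        g = (\<lambda>x. point_indicator P x - point_indicator Q x
                 + point_indicator R x - point_indicator S x))"

end

theory Submission imports Defs begin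

text \<open>
  Call two functions congruent when their difference is a sum of simple annihilation functions.
  The negative of a simple function is simple, so the sums of simple functions form a group, and
  congruence may be used like congruence modulo a subgroup.

  Fix a base point \<open>o\<close> of the grid. A rectangle with one side in direction \<open>i\<close> says that the difference
  \<open>\<one>\<^bsub>p(i := a)\<^esub> - \<one>\<^bsub>p\<^esub>\<close> does not change, up to congruence, when another coordinate of \<open>p\<close> is
  changed; hence only the \<open>i\<close>-th coordinate of \<open>p\<close> matters for it
  (\<open>axis_difference_base_change\<close>). Walking from \<open>o\<close> to \<open>x\<close> one coordinate at a
  time therefore gives
  \<open>\<one>\<^bsub>x\<^esub> \<equiv> \<one>\<^bsub>o\<^esub> + \<Sum>\<^sub>i (\<one>\<^bsub>o(i := x i)\<^esub> - \<one>\<^bsub>o\<^esub>)\<close>,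
  which is \<open>point_indicator_splits\<close>. Every summand on the right depends on at most one coordinate
  of \<open>x\<close>. Multiply by \<open>f x\<close> and sum over the grid: the left side becomes \<open>f\<close>, and the right side
  vanishes, because an annihilation function is orthogonal to every function of a single
  coordinate (\<open>annihilation_function_orthogonal\<close>).
\<close>

section \<open>The group generated by the simple annihilation functions\<close>

text \<open>Equality is demanded at all points, so that closure under sums needs no restriction to the
  grid. Simple annihilation functions vanish outside the grid, and so do all decomposable
  functions.\<close>

definition decomposable :: "nat \<Rightarrow> nat \<Rightarrow> ((nat \<Rightarrow> nat) \<Rightarrow> int) \<Rightarrow> bool" where
  "decomposable d n g \<longleftrightarrow>
     (\<exists>gs. (\<forall>h \<in> set gs. simple_annihilation_function d n h) \<and> (\<forall>x. g x = (\<Sum>h \<leftarrow> gs. h x)))"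

lemma decomposable_zero: "decomposable d n (\<lambda>x. 0)"
  unfolding decomposable_def by (rule exI[of _ "[]"]) simp

lemma decomposable_simple:
  "simple_annihilation_function d n g \<Longrightarrow> decomposable d n g"
  unfolding decomposable_def by (rule exI[of _ "[g]"]) simp

lemma decomposable_add:
  assumes "decomposable d n g" "decomposable d n h"
  shows "decomposable d n (\<lambda>x. g x + h x)"
proof -
  obtain gs hs where "\<forall>k \<in> set gs. simple_annihilation_function d n k"
      "\<forall>x. g x = (\<Sum>k \<leftarrow> gs. k x)"
      "\<forall>k \<in> set hs. simple_annihilation_function d n k" "\<forall>x. h x = (\<Sum>k \<leftarrow> hs. k x)"
    using assms unfolding decomposable_def by blast
  then show ?thesis
    unfolding decomposable_def by (intro exI[of _ "gs @ hs"]) auto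
qed

text \<open>Reading the vertices from \<open>Q\<close> in the opposite direction, as \<open>Q, P, S, R\<close>, exchanges the
  signs.\<close>

lemma simple_annihilation_function_uminus:
  assumes "simple_annihilation_function d n g"
  shows "simple_annihilation_function d n (\<lambda>x. - g x)"
proof -
  obtain P Q R S where rect: "axis_rectangle d n P Q R S"
    and g: "g = (\<lambda>x. point_indicator P x - point_indicator Q x
                      + point_indicator R x - point_indicator S x)"
    using assms unfolding simple_annihilation_function_def by blast
  from rect obtain i j a b where "i \<in> {1..d}" "j \<in> {1..d}" "i \<noteq> j" "a \<noteq> P i" "b \<noteq> P j"
      "Q = P(i := a)" "R = P(i := a, j := b)" "S = P(j := b)"
    unfolding axis_rectangle_def by blast
  then have "\<exists>i \<in> {1..d}. \<exists>j \<in> {1..d}. \<exists>a b. i \<noteq> j \<and> a \<noteq> Q i \<and> b \<noteq> Q j \<and>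
      P = Q(i := a) \<and> S = Q(i := a, j := b) \<and> R = Q(j := b)"
    by (intro bexI[of _ i] bexI[of _ j] exI[of _ "P i"] exI[of _ b]) auto
  then have "axis_rectangle d n Q P S R"
    using rect unfolding axis_rectangle_def by blast
  then show ?thesis
    unfolding simple_annihilation_function_def g by (intro exI conjI) (auto simp: fun_eq_iff)
qed

lemma decomposable_uminus:
  assumes "decomposable d n g"
  shows "decomposable d n (\<lambda>x. - g x)"
proof -
  obtain gs where gs: "\<forall>h \<in> set gs. simple_annihilation_function d n h"
      "\<forall>x. g x = (\<Sum>h \<leftarrow> gs. h x)"
    using assms unfolding decomposable_def by blast
  then have "- g x = (\<Sum>h \<leftarrow> map (\<lambda>h x. - h x) gs. h x)" for x
    by (simp add: uminus_sum_list_map comp_def)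
  moreover have "\<forall>h \<in> set (map (\<lambda>h x. - h x) gs). simple_annihilation_function d n h"
    using gs(1) simple_annihilation_function_uminus by auto
  ultimately show ?thesis
    unfolding decomposable_def by blast
qed

lemma decomposable_int_mult:
  assumes "decomposable d n g"
  shows "decomposable d n (\<lambda>x. c * g x)"
proof (induction c rule: int_induct[where k = 0])
  case base
  show ?case by (simp add: decomposable_zero)
next
  case (step1 i)
  show ?case using decomposable_add[OF step1(2) assms] by (simp add: algebra_simps)
next
  case (step2 i)
  show ?case
    using decomposable_add[OF step2(2) decomposable_uminus[OF assms]] by (simp add: algebra_simps)
qed

lemma decomposable_sum:
  assumes "\<And>i. i \<in> I \<Longrightarrow> decomposable d n (g i)"
  shows "decomposable d n (\<lambda>x. \<Sum>i\<in>I. g i x)"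
  using assms
  by (induction I rule: infinite_finite_induct)
    (auto intro: decomposable_zero decomposable_add)

section \<open>Indicators of points modulo simple annihilation functions\<close>

lemma grid_update: "p \<in> grid d n \<Longrightarrow> i \<in> {1..d} \<Longrightarrow> a \<in> {1..n} \<Longrightarrow> p(i := a) \<in> grid d n"
  unfolding grid_def by (auto simp: PiE_def extensional_def Pi_def)

lemma grid_override:
  "p \<in> grid d n \<Longrightarrow> q \<in> grid d n \<Longrightarrow> override_on p q J \<in> grid d n"
  unfolding grid_def by (auto simp: PiE_def extensional_def Pi_def override_on_def)

lemma override_on_insert_upd: "override_on p q (insert j J) = (override_on p q J)(j := q j)"
  by (simp add: override_on_def fun_eq_iff)

lemma grid_coordinate: "p \<in> grid d n \<Longrightarrow> i \<in> {1..d} \<Longrightarrow> p i \<in> {1..n}"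
  unfolding grid_def by (rule PiE_mem)

definition axis_difference :: "nat \<Rightarrow> nat \<Rightarrow> (nat \<Rightarrow> nat) \<Rightarrow> (nat \<Rightarrow> nat) \<Rightarrow> int" where
  "axis_difference i a p y = point_indicator (p(i := a)) y - point_indicator p y"

text \<open>Up to the degenerate cases, the difference is the simple annihilation function of the
  rectangle with corner \<open>p\<close> and sides in the directions \<open>i\<close> and \<open>j\<close>.\<close>

lemma axis_difference_step:
  assumes "p \<in> grid d n" "i \<in> {1..d}" "j \<in> {1..d}" "i \<noteq> j" "a \<in> {1..n}" "b \<in> {1..n}"
  shows "decomposable d n (\<lambda>y. axis_difference i a (p(j := b)) y - axis_difference i a p y)"
proof (cases "a = p i \<or> b = p j")
  case True
  have "p(j := b, i := p i) = p(j := b)"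
    using \<open>i \<noteq> j\<close> by (simp add: fun_eq_iff)
  then have "axis_difference i a (p(j := b)) y - axis_difference i a p y = 0" for y
    using True unfolding axis_difference_def by (auto simp del: fun_upd_apply)
  then show ?thesis by (simp add: decomposable_zero)
next
  case False
  then have "\<exists>k \<in> {1..d}. \<exists>l \<in> {1..d}. \<exists>a' b'. k \<noteq> l \<and> a' \<noteq> p k \<and> b' \<noteq> p l \<and>
      p(i := a) = p(k := a') \<and> p(i := a, j := b) = p(k := a', l := b') \<and> p(j := b) = p(l := b')"
    using assms by blast
  moreover have "p(i := a) \<in> grid d n" "p(i := a, j := b) \<in> grid d n" "p(j := b) \<in> grid d n"
    using assms by (simp_all only: grid_update)
  ultimately have "axis_rectangle d n p (p(i := a)) (p(i := a, j := b)) (p(j := b))"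
    unfolding axis_rectangle_def using assms(1) by blast
  then have "simple_annihilation_function d n
      (\<lambda>y. point_indicator p y - point_indicator (p(i := a)) y
          + point_indicator (p(i := a, j := b)) y - point_indicator (p(j := b)) y)"
    unfolding simple_annihilation_function_def by blast
  from decomposable_simple[OF this] show ?thesis
    using fun_upd_twist[OF \<open>i \<noteq> j\<close>, of p a b]
    by (simp add: axis_difference_def algebra_simps)
qed

text \<open>The coordinates in \<open>J\<close> are changed from those of \<open>p\<close> to those of \<open>q\<close> one by one; the
  differences of successive terms are decomposable by the preceding lemma.\<close>

lemma axis_difference_base_change:
  assumes "finite J" "J \<subseteq> {1..d} - {i}" "i \<in> {1..d}" "a \<in> {1..n}"
    and "p \<in> grid d n" "q \<in> grid d n"
  shows "decomposable d n
           (\<lambda>y. axis_difference i a (override_on p q J) y - axis_difference i a p y)"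
  using assms(1,2)
proof (induction J rule: finite_induct)
  case empty
  show ?case by (simp add: decomposable_zero)
next
  case (insert j J)
  have "decomposable d n (\<lambda>y. axis_difference i a ((override_on p q J)(j := q j)) y
                              - axis_difference i a (override_on p q J) y)"
    using insert.prems assms grid_coordinate[OF assms(6)]
    by (intro axis_difference_step grid_override) auto
  moreover have "decomposable d n
      (\<lambda>y. axis_difference i a (override_on p q J) y - axis_difference i a p y)"
    using insert by blast
  ultimately show ?case
    using decomposable_add[of d n "\<lambda>y. axis_difference i a ((override_on p q J)(j := q j)) y
                              - axis_difference i a (override_on p q J) y"
        "\<lambda>y. axis_difference i a (override_on p q J) y - axis_difference i a p y"]
    by (simp add: override_on_insert_upd del: fun_upd_apply)
qed

text \<open>Changing the coordinate \<open>i\<close> of the intermediate point on the way from \<open>p\<close> to \<open>x\<close>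
  contributes an axis difference based at that intermediate point; the base may be moved
  back to \<open>p\<close>, since the coordinate \<open>i\<close> has not been touched before.\<close>

lemma point_indicator_override_splits:
  assumes "finite J" "J \<subseteq> {1..d}" "p \<in> grid d n" "x \<in> grid d n"
  shows "decomposable d n (\<lambda>y. point_indicator (override_on p x J) y
           - (point_indicator p y + (\<Sum>i\<in>J. axis_difference i (x i) p y)))"
  using assms(1,2)
proof (induction J rule: finite_induct)
  case empty
  show ?case by (simp add: decomposable_zero)
next
  case (insert i J)
  have step: "decomposable d n (\<lambda>y. axis_difference i (x i) (override_on p x J) y
                              - axis_difference i (x i) p y)"
    using insert assms(3,4) grid_coordinate[OF assms(4)]
    by (intro axis_difference_base_change) auto
  have IH: "decomposable d n (\<lambda>y. point_indicator (override_on p x J) y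
           - (point_indicator p y + (\<Sum>k\<in>J. axis_difference k (x k) p y)))"
    using insert by blast
  show ?case
    using decomposable_add[OF step IH] insert.hyps
    by (simp add: override_on_insert_upd axis_difference_def algebra_simps del: fun_upd_apply)
qed

lemma point_indicator_splits:
  assumes "p \<in> grid d n" "x \<in> grid d n"
  shows "decomposable d n (\<lambda>y. point_indicator x y
           - (point_indicator p y + (\<Sum>i\<in>{1..d}. axis_difference i (x i) p y)))"
proof -
  have "override_on p x {1..d} = x"
    using assms unfolding grid_def override_on_def by (auto simp: fun_eq_iff PiE_def extensional_def)
  then show ?thesis
    using point_indicator_override_splits[of "{1..d}" d p n x] assms by simp
qed

section \<open>Annihilation functions\<close>

lemma finite_grid: "finite (grid d n)"
  unfolding grid_def by (intro finite_PiE) auto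

text \<open>A function of the coordinate \<open>i\<close> is constant on each layer perpendicular to the axis
  \<open>i\<close>, and these layers partition the grid.\<close>

lemma annihilation_function_orthogonal:
  assumes "annihilation_function d n f" "i \<in> {1..d}"
  shows "(\<Sum>x\<in>grid d n. f x * h (x i)) = 0"
proof -
  have layer_sum: "(\<Sum>x | x \<in> grid d n \<and> x i = a. f x) = 0" if "a \<in> {1..n}" for a
  proof -
    have "{x. x i = a} \<in> layers d n"
      using that assms(2) unfolding layers_def by blast
    then have "(\<Sum>x \<in> {x. x i = a} \<inter> grid d n. f x) = 0"
      using assms(1) unfolding annihilation_function_def by blast
    moreover have "{x. x i = a} \<inter> grid d n = {x. x \<in> grid d n \<and> x i = a}" by blast
    ultimately show ?thesis by simp
  qed
  have "(\<Sum>x\<in>grid d n. f x * h (x i))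
      = (\<Sum>a\<in>{1..n}. \<Sum>x | x \<in> grid d n \<and> x i = a. f x * h (x i))"
    using grid_coordinate assms(2) by (intro sum.group[symmetric] finite_grid) auto
  also have "\<dots> = (\<Sum>a\<in>{1..n}. (\<Sum>x | x \<in> grid d n \<and> x i = a. f x) * h a)"
    by (intro sum.cong refl) (simp add: sum_distrib_right)
  also have "\<dots> = 0"
    using layer_sum by simp
  finally show ?thesis .
qed

theorem theorem1p8:
  fixes d n :: nat and f :: "(nat \<Rightarrow> nat) \<Rightarrow> int"
  assumes "d \<ge> 2" and "n \<ge> 1"
    and "annihilation_function d n f"
  shows "\<exists>gs. (\<forall>g \<in> set gs. simple_annihilation_function d n g) \<and>
              (\<forall>x \<in> grid d n. f x = (\<Sum>g \<leftarrow> gs. g x))"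
proof -
  define p :: "nat \<Rightarrow> nat" where "p = restrict (\<lambda>_. 1) {1..d}"
  have p: "p \<in> grid d n"
    using \<open>n \<ge> 1\<close> unfolding p_def grid_def by auto
  have total: "(\<Sum>x\<in>grid d n. f x) = 0"
    using annihilation_function_orthogonal[OF assms(3), of 1 "\<lambda>_. 1"] \<open>d \<ge> 2\<close> by simp
  have axis: "(\<Sum>x\<in>grid d n. f x * axis_difference i (x i) p y) = 0" if "i \<in> {1..d}" for i y
    using annihilation_function_orthogonal[OF assms(3) that] .
  have "decomposable d n (\<lambda>y. \<Sum>x\<in>grid d n. f x * (point_indicator x y
           - (point_indicator p y + (\<Sum>i\<in>{1..d}. axis_difference i (x i) p y))))"
    by (intro decomposable_sum decomposable_int_mult point_indicator_splits p)
  moreover have "(\<Sum>x\<in>grid d n. f x * (point_indicator x y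
           - (point_indicator p y + (\<Sum>i\<in>{1..d}. axis_difference i (x i) p y)))) = f y"
    if "y \<in> grid d n" for y
  proof -
    have "(\<Sum>x\<in>grid d n. f x * (\<Sum>i\<in>{1..d}. axis_difference i (x i) p y))
        = (\<Sum>i\<in>{1..d}. \<Sum>x\<in>grid d n. f x * axis_difference i (x i) p y)"
      unfolding sum_distrib_left by (rule sum.swap)
    also have "\<dots> = 0"
      using axis by simp
    finally have "(\<Sum>x\<in>grid d n. f x * (\<Sum>i\<in>{1..d}. axis_difference i (x i) p y)) = 0" .
    moreover have "(\<Sum>x\<in>grid d n. f x * point_indicator p y) = 0"
      using total by (simp flip: sum_distrib_right)
    moreover have "(\<Sum>x\<in>grid d n. f x * point_indicator x y) = f y"
      using that finite_grid by (simp add: point_indicator_def if_distrib cong: if_cong)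
    ultimately show ?thesis
      by (simp add: right_diff_distrib distrib_left sum_subtractf sum.distrib)
  qed
  ultimately show ?thesis
    unfolding decomposable_def by metis
qed

end
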